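(* Let $t>1$ be an integer and let $n\ge 0$ be an integer. Then $D_n(1,x)$ is a permutation polynomial over $\mathbb{Z}_{2^t}$ if and only if $n\equiv 3\pmod 6$.
   Context: The $n$th reversed Dickson polynomial of the first kind (with parameter $1$) is the integer-coefficient polynomial $D_n(1,x)$ defined by $D_0(1,x)=2$, $D_1(1,x)=1$, $D_n(1,x)=D_{n-1}(1,x)-x\,D_{n-2}(1,x)$ for $n\ge 2$. $\mathbb{Z}_m$ is the ring of integers modulo $m$; an integer polynomial is a permutation polynomial over $\mathbb{Z}_m$ if the map it induces $\mathbb{Z}_m\to\mathbb{Z}_m$ is a bijection. *)

theory Defs
  imports "HOL-Computational_Algebra.Polynomial" "HOL-Number_Theory.Number_Theory"
begin

fun rev_dickson :: "nat \<Rightarrow> int poly" where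
  "rev_dickson 0 = 2"
| "rev_dickson (Suc 0) = 1"
| "rev_dickson (Suc (Suc n)) = rev_dickson (Suc n) - [:0, 1:] * rev_dickson n"

(* The carrier of residue_ring m is the set of representatives {0..m - 1}, so the map induced by
   f is evaluation over the integers followed by reduction modulo m. *)
definition permutation_poly_mod :: "int \<Rightarrow> int poly \<Rightarrow> bool" where
  "permutation_poly_mod m f \<longleftrightarrow>
     bij_betw (\<lambda>a. poly f a mod m) (carrier (residue_ring m)) (carrier (residue_ring m))"

end

theory Submission
  imports Defs
begin

text \<open>
  By Taylor expansion, \<open>f (x + h) - f x = h * (f' x + h * q)\<close>.  Hence an integer polynomial \<open>f\<close>
  permutes the residues modulo \<open>2 ^ t\<close> with \<open>t > 1\<close> as soon as it permutes the residues modulo \<open>2\<close>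
  and \<open>f' x\<close> is always odd: the second factor is then odd for every even \<open>h\<close>.  Conversely, taking
  \<open>h = 2 ^ (t - 1)\<close> shows that an even \<open>f' x\<close> destroys injectivity.  Both conditions only involve
  the values at \<open>0\<close> and \<open>1\<close>, whose parities are periodic in \<open>n\<close>.
\<close>

lemma diff_dvd_poly_diff:
  fixes p :: "'a::comm_ring_1 poly"
  shows "x - y dvd poly p x - poly p y"
proof (induction p)
  case (pCons a p)
  have "poly (pCons a p) x - poly (pCons a p) y = x * (poly p x - poly p y) + (x - y) * poly p y"
    by (simp add: algebra_simps)
  then show ?case
    using pCons.IH by simp
qed simp

lemma even_poly_cong:
  fixes p :: "int poly"
  assumes "even (x - y)"
  shows "even (poly p x) \<longleftrightarrow> even (poly p y)"
  using dvd_trans[OF assms diff_dvd_poly_diff[of x y p]] by simp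

text \<open>In the inductive step the second-order remainder of \<open>a + X * p\<close> is
  \<open>poly (pderiv p) x + (x + h) * q\<close>, read off from the product of \<open>x + h\<close>
  with the expansion of \<open>p\<close>.\<close>

lemma poly_add_taylor:
  fixes p :: "'a::{comm_ring_1,semiring_no_zero_divisors} poly"
  shows "\<exists>q. poly p (x + h) = poly p x + h * (poly (pderiv p) x + h * q)"
proof (induction p)
  case (pCons a p)
  then obtain q where q: "poly p (x + h) = poly p x + h * (poly (pderiv p) x + h * q)"
    by blast
  have "poly (pCons a p) (x + h) = poly (pCons a p) x
      + h * (poly (pderiv (pCons a p)) x + h * (poly (pderiv p) x + (x + h) * q))"
    unfolding poly_pCons q by (simp add: pderiv_pCons algebra_simps)
  then show ?case by blast
qed simp

text \<open>An injective map of a finite set into itself is surjective.\<close>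

lemma permutation_poly_mod_iff_inj:
  assumes "m > 1"
  shows "permutation_poly_mod m f \<longleftrightarrow> inj_on (\<lambda>a. poly f a mod m) {0..m - 1}"
proof -
  have carrier: "carrier (residue_ring m) = {0..m - 1}"
    by (simp add: residue_ring_def)
  have "(\<lambda>a. poly f a mod m) ` {0..m - 1} \<subseteq> {0..m - 1}"
    using assms by auto
  then show ?thesis
    unfolding permutation_poly_mod_def carrier bij_betw_def
    by (metis endo_inj_surj finite_atLeastAtMost_int)
qed

lemma permutation_poly_mod_power_two_iff:
  fixes f :: "int poly"
  assumes "t > 1"
  shows "permutation_poly_mod (2 ^ t) f \<longleftrightarrow>
    odd (poly f 0 + poly f 1) \<and> odd (poly (pderiv f) 0) \<and> odd (poly (pderiv f) 1)"
    (is "?L \<longleftrightarrow> ?R")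
proof -
  let ?m = "2 ^ t :: int"
  have m: "?m > 1"
    using assms by (simp add: one_less_power)
  have m_even: "even ?m"
    using assms by simp
  show ?thesis
  proof
    assume ?L
    then have inj: "inj_on (\<lambda>a. poly f a mod ?m) {0..?m - 1}"
      and surj: "(\<lambda>a. poly f a mod ?m) ` {0..?m - 1} = {0..?m - 1}"
      by (auto simp: permutation_poly_mod_def bij_betw_def residue_ring_def)
    have half: "?m = 2 * 2 ^ (t - 1)" and half_even: "even (2 ^ (t - 1) :: int)"
      using assms by (simp_all flip: power_Suc)
    have half_ge: "(2::int) \<le> 2 ^ (t - 1)"
      using assms self_le_power[of "2::int" "t - 1"] by simp
    have "odd (poly f 0 + poly f 1)"
    proof
      assume "even (poly f 0 + poly f 1)"
      \<comment> \<open>If \<open>f\<close> agrees in parity at 0 and 1, all its values share one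
        parity; reduction modulo an even number keeps it, so 0 and 1 are not both attained.\<close>
      then have const: "even (poly f a) \<longleftrightarrow> even (poly f 0)" for a
        using even_poly_cong[of a 0 f] even_poly_cong[of a 1 f] by (cases "even a") auto
      have "0 \<in> {0..?m - 1}" "1 \<in> {0..?m - 1}"
        using m by auto
      then obtain a b where "poly f a mod ?m = 0" "poly f b mod ?m = 1"
        using surj by (metis (no_types, lifting) imageE)
      then have "even (poly f a)" "odd (poly f b)"
        using m_even by (metis dvd_mod_iff dvd_0_right, metis dvd_mod_iff odd_one)
      then show False
        using const by blast
    qed
    moreover have "odd (poly (pderiv f) x)" if "x \<in> {0, 1}" for x
    proof
      assume "even (poly (pderiv f) x)"
      moreover obtain q where
        "poly f (x + 2 ^ (t - 1)) = poly f x + 2 ^ (t - 1) * (poly (pderiv f) x + 2 ^ (t - 1) * q)"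
        using poly_add_taylor by blast
      \<comment> \<open>The second factor is even because both \<open>poly (pderiv f) x\<close> and
        \<open>2 ^ (t - 1)\<close> are; the latter is where \<open>t > 1\<close> enters.\<close>
      ultimately have "?m dvd poly f (x + 2 ^ (t - 1)) - poly f x"
        unfolding half using half_even by (simp add: mult.commute[of 2])
      then have "poly f (x + 2 ^ (t - 1)) mod ?m = poly f x mod ?m"
        by (simp add: mod_eq_dvd_iff)
      moreover have "x \<in> {0..?m - 1}" "x + 2 ^ (t - 1) \<in> {0..?m - 1}"
        using that half half_ge by auto
      ultimately show False
        using inj_onD[OF inj, of "x + 2 ^ (t - 1)" x] half_ge by auto
    qed
    ultimately show ?R by simp
  next
    assume R: ?R
    have deriv: "odd (poly (pderiv f) x)" for x
      using R even_poly_cong[of x 0 "pderiv f"] even_poly_cong[of x 1 "pderiv f"]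
      by (cases "even x") auto
    have "inj_on (\<lambda>a. poly f a mod ?m) {0..?m - 1}"
    proof (rule inj_onI)
      fix x y
      assume x: "x \<in> {0..?m - 1}" and y: "y \<in> {0..?m - 1}"
        and "poly f x mod ?m = poly f y mod ?m"
      then have dvd: "?m dvd poly f y - poly f x"
        by (metis mod_eq_dvd_iff)
      have "even (poly f y - poly f x)"
        using dvd_trans[OF m_even dvd] .
      \<comment> \<open>Values at 0 and 1 differ in parity, so the parity of \<open>f x\<close>
        determines that of \<open>x\<close>.\<close>
      then have even: "even (y - x)"
        using R even_poly_cong[of x 0 f] even_poly_cong[of x 1 f]
          even_poly_cong[of y 0 f] even_poly_cong[of y 1 f]
        by auto
      obtain q where
        "poly f (x + (y - x)) = poly f x + (y - x) * (poly (pderiv f) x + (y - x) * q)"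
        using poly_add_taylor by blast
      then have "?m dvd (y - x) * (poly (pderiv f) x + (y - x) * q)"
        using dvd by simp
      moreover have "coprime ?m (poly (pderiv f) x + (y - x) * q)"
        using deriv even by simp
      ultimately have "?m dvd y - x"
        by (simp add: coprime_dvd_mult_left_iff)
      then have "y mod ?m = x mod ?m"
        by (simp add: mod_eq_dvd_iff)
      then show "x = y"
        using x y by simp
    qed
    then show ?L
      using permutation_poly_mod_iff_inj m by blast
  qed
qed

lemma poly_rev_dickson_0: "n > 0 \<Longrightarrow> poly (rev_dickson n) 0 = 1"
  by (induction n rule: rev_dickson.induct) auto

text \<open>At 0 the derivatives satisfy d(n+2) = d(n+1) - D(n)(0). Each step subtracts 1, except
  the first, which subtracts D(0) = 2; hence the exception at \<open>n = 1\<close>.\<close>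

lemma poly_pderiv_rev_dickson_0:
  "n > 0 \<Longrightarrow> poly (pderiv (rev_dickson n)) 0 = (if n = 1 then 0 else - int n)"
proof (induction n rule: rev_dickson.induct)
  case (3 n)
  then show ?case
    using poly_rev_dickson_0[of n]
    by (cases n) (auto simp: pderiv_diff pderiv_mult pderiv_pCons)
qed auto

text \<open>Modulo 2 the values at 1 obey the Fibonacci recurrence from 0, 1, which has period
  3.\<close>

lemma even_poly_rev_dickson_1: "even (poly (rev_dickson n) 1) \<longleftrightarrow> n mod 3 = 0"
proof (induction n rule: rev_dickson.induct)
  case (3 n)
  have "n mod 3 = 0 \<or> n mod 3 = 1 \<or> n mod 3 = 2"
    by linarith
  then show ?case
    using 3 by (auto simp: mod_Suc)
qed auto

text \<open>The derivatives at 1 satisfy d(n+2) = d(n+1) - d(n) - D(n)(1). Modulo 2 they run through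
  0, 0, 0, 1, 0, 1 with period 6.\<close>

lemma even_poly_pderiv_rev_dickson_1:
  "even (poly (pderiv (rev_dickson n)) 1) \<longleftrightarrow> n mod 6 \<notin> {3, 5}"
proof (induction n rule: rev_dickson.induct)
  case (3 n)
  have "n mod 6 \<in> {0, 1, 2, 3, 4, 5}"
    by auto
  moreover have "n mod 3 = n mod 6 mod 3"
    by (simp add: mod_mod_cancel)
  ultimately show ?case
    using 3 even_poly_rev_dickson_1[of n]
    by (auto simp: mod_Suc pderiv_diff pderiv_mult pderiv_pCons)
qed auto

theorem theorem3p20:
  fixes t n :: nat
  assumes "t > 1"
  shows "permutation_poly_mod (2 ^ t) (rev_dickson n) \<longleftrightarrow> [n = 3] (mod 6)"
proof (cases "n = 0")
  case True
  then show ?thesis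
    by (simp add: permutation_poly_mod_power_two_iff[OF assms] cong_def)
next
  case False
  have "n mod 6 \<in> {0, 1, 2, 3, 4, 5}"
    by auto
  moreover have "n mod 3 = n mod 6 mod 3" "even n \<longleftrightarrow> even (n mod 6)"
    by (simp_all add: mod_mod_cancel dvd_mod_iff)
  ultimately show ?thesis
    \<comment> \<open>As D(n)(0) = 1, the first condition says that 3 divides \<open>n\<close>, and
      the second then says that \<open>n\<close> is odd. Together they give residue 3 modulo 6,
      where the third holds too.\<close>
    unfolding permutation_poly_mod_power_two_iff[OF assms]
    using False poly_rev_dickson_0[of n] poly_pderiv_rev_dickson_0[of n]
      even_poly_rev_dickson_1[of n] even_poly_pderiv_rev_dickson_1[of n]
    by (auto simp: cong_def split: if_splits)
qed

end
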